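(* Let $c>1$ be a constant. There exists a function $h:\mathbb R_+\to\mathbb R_+$ satisfying $h(0+)=\lim_{x\downarrow0}h(x)=0$ such that the following holds: for any $1\le K\le N$, any $C>0$, and any $q$ with $q\le C\left(\frac1K\log\frac{eN}{K}\wedge\frac{N^2}{K^4}\right)$, setting $p=cq$ (with $p \le 1$), $$d_{\rm TV}(\mathbb P_0,\mathbb P_1)\le h(Cc^2)+\exp(-K/8),$$ where $\mathbb P_0$ is the law of $\mathcal G(N,q)$ and $\mathbb P_1$ is the law of $\mathcal G(N,K,p,q)$.
   Context: $\mathcal G(N,q)$ is the Erdős–Rényi random graph on $N$ vertices, each pair of vertices being connected independently with probability $q$. $\mathcal G(N,K,p,q)$ (with $p>q$) is the planted dense subgraph model on $N$ vertices: each vertex is included in a random set $S$ independently with probability $K/N$; given $S$, each pair of vertices is connected independently, with probability $p$ if both vertices are in $S$ and with probability $q$ otherwise. $d_{\rm TV}(\mathbb P,\mathbb Q)=\frac12\int|d\mathbb P-d\mathbb Q|$ is the total variation distance, $a\wedge b=\min\{a,b\}$, and $\log$ is the natural logarithm. *)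

theory Defs
  imports "HOL-Probability.Probability" "HOL-Probability.Product_PMF"
begin

definition random_subset :: "'a set \<Rightarrow> ('a \<Rightarrow> real) \<Rightarrow> 'a set pmf" where
  "random_subset A r =
     map_pmf (\<lambda>b. {x \<in> A. b x}) (Pi_pmf A False (\<lambda>x. bernoulli_pmf (r x)))"

definition vertex_pairs :: "nat \<Rightarrow> nat set set" where
  "vertex_pairs N = {e. e \<subseteq> {..<N} \<and> card e = 2}"

text \<open>A simple graph on the fixed vertex set \<open>{..<N}\<close> is represented by its set of edges,
  a subset of \<^term>\<open>vertex_pairs N\<close>.\<close>

definition erdos_renyi :: "nat \<Rightarrow> real \<Rightarrow> nat set set pmf" where
  "erdos_renyi N q = random_subset (vertex_pairs N) (\<lambda>_. q)"

definition planted_dense_subgraph :: "nat \<Rightarrow> real \<Rightarrow> real \<Rightarrow> real \<Rightarrow> nat set set pmf" where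
  "planted_dense_subgraph N K p q =
     bind_pmf (random_subset {..<N} (\<lambda>_. K / real N))
       (\<lambda>S. random_subset (vertex_pairs N) (\<lambda>e. if e \<subseteq> S then p else q))"

text \<open>For discrete laws, \<open>1/2 \<integral> |dP - dQ|\<close> with counting measure as the dominating measure.\<close>

definition tv_dist :: "'a pmf \<Rightarrow> 'a pmf \<Rightarrow> real" where
  "tv_dist P Q = 1 / 2 * (LINT x|count_space UNIV. \<bar>pmf P x - pmf Q x\<bar>)"

end

theory Submission imports Defs begin

text \<open>
  A truncated second moment argument, with \<open>h x = e\<^sup>4 \<surd>x\<close>. Planted sets with more than \<open>2 K\<close>
  elements have total weight at most \<open>exp (- K / 8)\<close>; on the others, Cauchy--Schwarz bounds the
  distance by the square root of the mean of \<open>(1 + \<theta>) ^ (H choose 2) - 1\<close>, where \<open>H\<close> is the overlap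
  of two independent planted sets and \<open>\<theta> = (p - q)\<^sup>2 / (q (1 - q)) \<le> c\<^sup>2 q\<close>. With \<open>x = C c\<^sup>2\<close>, convexity
  of the exponential extracts a factor \<open>e\<^sup>8 x\<close> from this mean and leaves an exponential moment at
  the fixed scale \<open>x = e\<^sup>-\<^sup>8\<close>, which only has to be bounded by a constant. Put \<open>\<mu> = K\<^sup>2 / N\<close>, the mean
  of \<open>H\<close>. Overlaps \<open>H \<le> e\<^sup>4 \<mu>\<close> are harmless because \<open>q \<le> C / \<mu>\<^sup>2\<close>; larger ones have
  probability at most \<open>(e \<mu> / H) ^ H\<close>, which beats the exponential because
  \<open>q \<le> C / K * ln (e N / K)\<close> and \<open>H \<le> 2 K\<close>.
\<close>

section \<open>Independent random subsets, total variation and exponential inequalities\<close>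

text \<open>Expanding the product chooses one of two summands at each element, and the set of
  elements where \<open>f\<close> is chosen runs through \<open>Pow A\<close>. Expectations of
  products over independent random subsets are evaluated this way.\<close>

lemma sum_Pow_prod_if:
  fixes f g :: "'a \<Rightarrow> 'b :: comm_semiring_1"
  assumes "finite A"
  shows "(\<Sum>X\<in>Pow A. \<Prod>x\<in>A. if x \<in> X then f x else g x) = (\<Prod>x\<in>A. f x + g x)"
proof -
  have "(\<Prod>x\<in>A. if x \<in> X then f x else g x) = prod f X * prod g (A - X)" if "X \<in> Pow A" for X
  proof -
    have "A \<inter> X = X" "A \<inter> - X = A - X" using that by auto
    then show ?thesis using assms prod.If_cases[of A "\<lambda>x. x \<in> X" f g] by simp
  qed
  then show ?thesis using prod_add[OF assms, of f g] by simp
qed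

lemma pmf_random_subset:
  assumes "finite A" "\<And>x. x \<in> A \<Longrightarrow> r x \<in> {0..1}"
  shows "pmf (random_subset A r) X =
    (if X \<subseteq> A then \<Prod>x\<in>A. if x \<in> X then r x else 1 - r x else 0)"
proof -
  let ?M = "Pi_pmf A False (\<lambda>x. bernoulli_pmf (r x))"
  let ?f = "\<lambda>b. {x \<in> A. b x}"
  \<comment> \<open>On the support \<open>b\<close> has the default value \<open>False\<close> off
    \<open>A\<close>, so it can be recovered from \<open>{x \<in> A. b x}\<close> and the event that
    the random subset is \<open>X\<close> consists of one function.\<close>
  have dflt: "b x = False" if "b \<in> set_pmf ?M" "x \<notin> A" for b x
    using that set_Pi_pmf_subset[OF assms(1), of False "\<lambda>x. bernoulli_pmf (r x)"] by auto
  have pmf: "pmf (random_subset A r) X = measure_pmf.prob ?M (?f -` {X} \<inter> set_pmf ?M)"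
    unfolding random_subset_def by (simp add: pmf_map measure_Int_set_pmf)
  show ?thesis
  proof (cases "X \<subseteq> A")
    case True
    let ?b = "\<lambda>x. x \<in> X"
    have "?f -` {X} \<inter> set_pmf ?M = {?b} \<inter> set_pmf ?M"
    proof (intro equalityI subsetI)
      fix b assume b: "b \<in> ?f -` {X} \<inter> set_pmf ?M"
      then have "b x = (x \<in> X)" for x using dflt[of b x] True by (cases "x \<in> A") auto
      then show "b \<in> {?b} \<inter> set_pmf ?M" using b by auto
    qed (use True in auto)
    then have "pmf (random_subset A r) X = pmf ?M ?b"
      by (simp add: pmf measure_Int_set_pmf measure_pmf_single)
    also have "\<dots> = (\<Prod>x\<in>A. if x \<in> X then r x else 1 - r x)"
      using assms True by (subst pmf_Pi') (auto intro!: prod.cong)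
    finally show ?thesis using True by simp
  next
    case False
    then have "?f -` {X} = {}" by auto
    then show ?thesis using False pmf by simp
  qed
qed

lemma tv_dist_finite_support:
  assumes "finite \<Omega>" "\<And>x. x \<notin> \<Omega> \<Longrightarrow> pmf P x = 0" "\<And>x. x \<notin> \<Omega> \<Longrightarrow> pmf Q x = 0"
  shows "tv_dist P Q = 1 / 2 * (\<Sum>x\<in>\<Omega>. \<bar>pmf P x - pmf Q x\<bar>)"
proof -
  have sub: "{x. pmf P x \<noteq> pmf Q x} \<subseteq> \<Omega>" using assms(2,3) by fastforce
  have "(LINT x|count_space UNIV. \<bar>pmf P x - pmf Q x\<bar>) =
      (\<Sum>x | x \<in> UNIV \<and> \<bar>pmf P x - pmf Q x\<bar> \<noteq> 0. \<bar>pmf P x - pmf Q x\<bar>)"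
    using finite_subset[OF sub assms(1)]
    by (intro lebesgue_integral_count_space_finite_support) auto
  also have "\<dots> = (\<Sum>x\<in>\<Omega>. \<bar>pmf P x - pmf Q x\<bar>)"
    using assms(1) sub by (intro sum.mono_neutral_left) auto
  finally show ?thesis by (simp add: tv_dist_def)
qed

text \<open>One term of the exponential series is at most the whole series. The case
  \<open>x = n\<close> is the Stirling-type bound \<open>n ^ n \<le> fact n * exp n\<close> used for
  binomial coefficients.\<close>

lemma power_le_fact_mult_exp:
  fixes x :: real
  assumes "0 \<le> x"
  shows "x ^ n \<le> fact n * exp x"
proof -
  have "(\<Sum>k\<in>{n}. x ^ k /\<^sub>R fact k) \<le> exp x"
    unfolding exp_def by (rule sum_le_suminf[OF summable_exp_generic]) (use assms in auto)
  then show ?thesis by (simp add: field_simps)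
qed

text \<open>By convexity the graph of \<open>exp\<close> between \<open>0\<close> and
  \<open>t\<close> lies below its chord.\<close>

lemma exp_mult_diff_le:
  fixes s t :: real
  assumes "0 \<le> s" "s \<le> 1"
  shows "exp (s * t) - 1 \<le> s * (exp t - 1)"
proof -
  have "exp ((1 - s) *\<^sub>R 0 + s *\<^sub>R t) \<le> (1 - s) * exp 0 + s * exp t"
    using assms by (intro convex_onD[OF exp_convex]) auto
  then show ?thesis by (simp add: algebra_simps)
qed

section \<open>Containment probabilities and upper tail of a binomial random subset\<close>

lemma random_subset_superset_prob:
  fixes r :: real
  assumes "finite A" "T \<subseteq> A" "r \<in> {0..1}"
  shows "(\<Sum>S\<in>Pow A. if T \<subseteq> S then pmf (random_subset A (\<lambda>_. r)) S else 0) = r ^ card T"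
proof -
  \<comment> \<open>Giving the absence of an element of \<open>T\<close> the weight \<open>0\<close>
    encodes the condition \<open>T \<subseteq> S\<close> in the product itself, so the sum can run
    over all of \<open>Pow A\<close>.\<close>
  have "(if T \<subseteq> S then pmf (random_subset A (\<lambda>_. r)) S else 0) =
      (\<Prod>x\<in>A. if x \<in> S then r else if x \<in> T then 0 else 1 - r)" if "S \<in> Pow A" for S
  proof (cases "T \<subseteq> S")
    case True
    then show ?thesis using assms that by (auto simp: pmf_random_subset intro!: prod.cong)
  next
    case False
    then obtain x where "x \<in> T" "x \<notin> S" by auto
    then show ?thesis using assms False by (auto intro!: prod_zero bexI[of _ x])
  qed
  then have "(\<Sum>S\<in>Pow A. if T \<subseteq> S then pmf (random_subset A (\<lambda>_. r)) S else 0) =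
      (\<Prod>x\<in>A. r + (if x \<in> T then 0 else 1 - r))"
    using sum_Pow_prod_if[OF assms(1), of "\<lambda>_. r" "\<lambda>x. if x \<in> T then 0 else 1 - r"] by simp
  also have "\<dots> = (\<Prod>x\<in>A. if x \<in> T then r else 1)"
    by (intro prod.cong) auto
  also have "\<dots> = r ^ card T"
    using assms by (simp add: prod.If_cases Int_absorb1)
  finally show ?thesis .
qed

text \<open>Exponential Markov inequality for \<open>2 ^ card S\<close>. With
  \<open>m = r * card A\<close>, its mean is \<open>(1 + r) ^ card A \<le> exp m\<close>, while on
  the event it is at least \<open>exp (9 / 8 * m)\<close>; the quotient is
  \<open>exp (- m / 8)\<close>.\<close>

lemma random_subset_Chernoff:
  fixes r :: real
  assumes "finite A" "r \<in> {0..1}"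
  shows "(\<Sum>S | S \<subseteq> A \<and> 2 * (r * card A) < card S. pmf (random_subset A (\<lambda>_. r)) S)
    \<le> exp (- (r * card A) / 8)"
proof -
  let ?m = "r * card A" and ?w = "\<lambda>S. pmf (random_subset A (\<lambda>_. r)) S"
  \<comment> \<open>The constant is half of \<open>9 / 8 = 1 + 1 / 8\<close>, since
    \<open>card S\<close> exceeds twice the mean; it is below \<open>ln 2\<close>, so base
    \<open>2\<close> suffices.\<close>
  have "exp (9/16 :: real) \<le> 1 + 9/16 + (9/16)\<^sup>2" by (intro exp_bound) auto
  then have e: "exp (9/16 :: real) \<le> 2" by (simp add: power2_eq_square)
  have "(\<Sum>S | S \<subseteq> A \<and> 2 * ?m < card S. ?w S) \<le>
      (\<Sum>S | S \<subseteq> A \<and> 2 * ?m < card S. exp (- (9 / 8 * ?m)) * (2 ^ card S * ?w S))"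
  proof (intro sum_mono)
    fix S assume "S \<in> {S. S \<subseteq> A \<and> 2 * ?m < card S}"
    then have "exp (9 / 8 * ?m) \<le> exp (9 / 16 * card S)" by simp
    also have "\<dots> = exp (9 / 16) ^ card S" by (metis exp_of_nat2_mult)
    also have "\<dots> \<le> 2 ^ card S" by (intro power_mono e) auto
    finally have "1 \<le> exp (- (9 / 8 * ?m)) * 2 ^ card S" by (simp add: exp_minus field_simps)
    then show "?w S \<le> exp (- (9 / 8 * ?m)) * (2 ^ card S * ?w S)"
      by (simp add: mult.assoc[symmetric] mult_le_cancel_right1)
  qed
  also have "\<dots> \<le> (\<Sum>S\<in>Pow A. exp (- (9 / 8 * ?m)) * (2 ^ card S * ?w S))"
    using assms by (intro sum_mono2) auto
  also have "(\<Sum>S\<in>Pow A. exp (- (9 / 8 * ?m)) * (2 ^ card S * ?w S)) =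
      exp (- (9 / 8 * ?m)) * (\<Sum>S\<in>Pow A. \<Prod>x\<in>A. if x \<in> S then 2 * r else 1 - r)"
  proof (subst sum_distrib_left, intro sum.cong refl)
    fix S assume "S \<in> Pow A"
    then have "(2::real) ^ card S = (\<Prod>x\<in>A. if x \<in> S then 2 else 1)"
      using assms by (simp add: prod.If_cases Int_absorb1)
    then have "2 ^ card S * ?w S = (\<Prod>x\<in>A. if x \<in> S then 2 * r else 1 - r)"
      using assms \<open>S \<in> Pow A\<close>
      by (auto simp: pmf_random_subset prod.distrib[symmetric] intro!: prod.cong)
    then show "exp (- (9 / 8 * ?m)) * (2 ^ card S * ?w S) =
      exp (- (9 / 8 * ?m)) * (\<Prod>x\<in>A. if x \<in> S then 2 * r else 1 - r)" by simp
  qed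
  also have "(\<Sum>S\<in>Pow A. \<Prod>x\<in>A. if x \<in> S then 2 * r else 1 - r) = (1 + r) ^ card A"
    using assms by (simp add: sum_Pow_prod_if add.commute)
  also have "\<dots> \<le> exp r ^ card A"
    using assms by (intro power_mono exp_ge_add_one_self) auto
  also have "exp r ^ card A = exp ?m" by (metis exp_of_nat2_mult)
  finally show ?thesis by (simp add: exp_add[symmetric] field_simps)
qed

section \<open>Truncated second moment bound for mixtures\<close>

text \<open>Components outside \<open>J\<close> are removed by the triangle inequality, each costing
  at most twice its weight. Only the rest goes through Cauchy--Schwarz with weight \<open>P\<close>,
  so rare components with a large likelihood ratio stay out of the second moment.\<close>

lemma mixture_l1_dist_le_second_moment:
  fixes P :: "'a \<Rightarrow> real" and R :: "'b \<Rightarrow> 'a \<Rightarrow> real" and w :: "'b \<Rightarrow> real"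
  assumes "finite I" "J \<subseteq> I"
    and P: "\<And>x. x \<in> \<Omega> \<Longrightarrow> 0 < P x" "sum P \<Omega> = 1"
    and R: "\<And>s x. s \<in> I \<Longrightarrow> x \<in> \<Omega> \<Longrightarrow> 0 \<le> R s x" "\<And>s. s \<in> I \<Longrightarrow> sum (R s) \<Omega> = 1"
    and w: "\<And>s. s \<in> I \<Longrightarrow> 0 \<le> w s" "sum w I = 1"
  shows "(\<Sum>x\<in>\<Omega>. \<bar>P x - (\<Sum>s\<in>I. w s * R s x)\<bar>) \<le> 2 * sum w (I - J) +
    sqrt (\<Sum>s\<in>J. \<Sum>t\<in>J. w s * w t * ((\<Sum>x\<in>\<Omega>. R s x * R t x / P x) - 1))"
proof -
  define D where "D x = (\<Sum>s\<in>J. w s * (P x - R s x))" for x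
  define B where "B x = (\<Sum>s\<in>I-J. w s * (P x + R s x))" for x
  have sub: "s \<in> I" if "s \<in> J" for s using assms(2) that by auto
  have "\<bar>P x - (\<Sum>s\<in>I. w s * R s x)\<bar> \<le> \<bar>D x\<bar> + B x" if x: "x \<in> \<Omega>" for x
  proof -
    have "P x = (\<Sum>s\<in>I. w s * P x)" using w(2) by (simp add: sum_distrib_right[symmetric])
    then have "P x - (\<Sum>s\<in>I. w s * R s x) = (\<Sum>s\<in>I. w s * (P x - R s x))"
      by (simp add: right_diff_distrib sum_subtractf)
    also have "\<dots> = (\<Sum>s\<in>I-J. w s * (P x - R s x)) + D x"
      unfolding D_def using assms(1,2) by (rule sum.subset_diff[OF _ _, rotated])
    finally have "\<bar>P x - (\<Sum>s\<in>I. w s * R s x)\<bar> \<le> \<bar>D x\<bar> + \<bar>\<Sum>s\<in>I-J. w s * (P x - R s x)\<bar>"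
      by linarith
    also have "\<bar>\<Sum>s\<in>I-J. w s * (P x - R s x)\<bar> \<le> (\<Sum>s\<in>I-J. \<bar>w s * (P x - R s x)\<bar>)"
      by (rule sum_abs)
    also have "\<dots> \<le> B x"
      unfolding B_def
    proof (intro sum_mono)
      fix s assume "s \<in> I - J"
      then have "0 \<le> w s" "\<bar>P x - R s x\<bar> \<le> P x + R s x"
        using w(1) R(1)[of s x] P(1)[OF x] x by auto
      then show "\<bar>w s * (P x - R s x)\<bar> \<le> w s * (P x + R s x)"
        by (simp add: abs_mult mult_left_mono)
    qed
    finally show ?thesis by simp
  qed
  then have "(\<Sum>x\<in>\<Omega>. \<bar>P x - (\<Sum>s\<in>I. w s * R s x)\<bar>) \<le> (\<Sum>x\<in>\<Omega>. \<bar>D x\<bar>) + sum B \<Omega>"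
    by (simp add: sum_mono sum.distrib[symmetric])
  moreover have "sum B \<Omega> = 2 * sum w (I - J)"
  proof -
    have "sum B \<Omega> = (\<Sum>s\<in>I-J. w s * (\<Sum>x\<in>\<Omega>. P x + R s x))"
      unfolding B_def by (subst sum.swap) (simp add: sum_distrib_left)
    also have "\<dots> = (\<Sum>s\<in>I-J. w s * 2)"
      using P(2) R(2) by (intro sum.cong) (auto simp: sum.distrib)
    finally show ?thesis by (simp add: sum_distrib_right[symmetric])
  qed
  moreover have "(\<Sum>x\<in>\<Omega>. \<bar>D x\<bar>) \<le> sqrt (\<Sum>x\<in>\<Omega>. (D x)\<^sup>2 / P x)"
  proof (rule real_le_rsqrt)
    have "(\<Sum>x\<in>\<Omega>. \<bar>D x\<bar>)\<^sup>2 = (\<Sum>x\<in>\<Omega>. sqrt (P x) * (\<bar>D x\<bar> / sqrt (P x)))\<^sup>2"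
      using P(1) by (intro arg_cong[where f="\<lambda>z. z\<^sup>2"] sum.cong) (auto simp: less_imp_neq[symmetric])
    also have "\<dots> \<le> (\<Sum>x\<in>\<Omega>. (sqrt (P x))\<^sup>2) * (\<Sum>x\<in>\<Omega>. (\<bar>D x\<bar> / sqrt (P x))\<^sup>2)"
      by (rule Cauchy_Schwarz_ineq_sum)
    also have "(\<Sum>x\<in>\<Omega>. (sqrt (P x))\<^sup>2) = sum P \<Omega>"
      using P(1) less_imp_le by (intro sum.cong) auto
    also have "(\<Sum>x\<in>\<Omega>. (\<bar>D x\<bar> / sqrt (P x))\<^sup>2) = (\<Sum>x\<in>\<Omega>. (D x)\<^sup>2 / P x)"
      using P(1) less_imp_le by (intro sum.cong) (auto simp: power_divide)
    finally show "(\<Sum>x\<in>\<Omega>. \<bar>D x\<bar>)\<^sup>2 \<le> (\<Sum>x\<in>\<Omega>. (D x)\<^sup>2 / P x)" by (simp add: P(2))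
  qed
  moreover have "(\<Sum>x\<in>\<Omega>. (D x)\<^sup>2 / P x) =
    (\<Sum>s\<in>J. \<Sum>t\<in>J. w s * w t * ((\<Sum>x\<in>\<Omega>. R s x * R t x / P x) - 1))"
  proof -
    \<comment> \<open>After summation over \<open>x\<close> the three linear terms contribute
      \<open>1 - 1 - 1 = - 1\<close>, which is the origin of the \<open>- 1\<close> in the
      claim.\<close>
    have "(D x)\<^sup>2 / P x =
        (\<Sum>s\<in>J. \<Sum>t\<in>J. w s * w t * (P x - R s x - R t x + R s x * R t x / P x))"
      if "x \<in> \<Omega>" for x
      unfolding D_def power2_eq_square sum_product sum_divide_distrib
      using P(1)[OF that] by (intro sum.cong refl) (simp add: field_simps)
    then have "(\<Sum>x\<in>\<Omega>. (D x)\<^sup>2 / P x) =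
        (\<Sum>x\<in>\<Omega>. \<Sum>s\<in>J. \<Sum>t\<in>J. w s * w t * (P x - R s x - R t x + R s x * R t x / P x))"
      by simp
    also have "\<dots> = (\<Sum>s\<in>J. \<Sum>t\<in>J. w s * w t *
        (\<Sum>x\<in>\<Omega>. P x - R s x - R t x + R s x * R t x / P x))"
      by (subst sum.swap, rule sum.cong[OF refl], subst sum.swap) (simp add: sum_distrib_left)
    also have "\<dots> = (\<Sum>s\<in>J. \<Sum>t\<in>J. w s * w t * ((\<Sum>x\<in>\<Omega>. R s x * R t x / P x) - 1))"
      using P(2) R(2) sub by (intro sum.cong refl) (simp add: sum.distrib sum_subtractf)
    finally show ?thesis .
  qed
  ultimately show ?thesis by simp
qed

text \<open>The sum factors over \<open>E\<close>. Where at most one of the two laws is tilted, a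
  factor cancels against the denominator and a probability summing to \<open>1\<close> remains; on
  \<open>U \<inter> V\<close> the factor is
  \<open>p\<^sup>2 / q + (1 - p)\<^sup>2 / (1 - q)\<close>.\<close>

lemma random_subset_likelihood_overlap:
  fixes p q :: real
  assumes "finite E" "0 < q" "q < 1" "p \<in> {0..1}"
  shows "(\<Sum>G\<in>Pow E. pmf (random_subset E (\<lambda>e. if e \<in> U then p else q)) G *
        pmf (random_subset E (\<lambda>e. if e \<in> V then p else q)) G / pmf (random_subset E (\<lambda>_. q)) G)
    = (1 + (p - q)\<^sup>2 / (q * (1 - q))) ^ card (E \<inter> U \<inter> V)"
proof -
  let ?a = "\<lambda>U e. if e \<in> U then p else q"
  have "(\<Sum>G\<in>Pow E. pmf (random_subset E (?a U)) G *
        pmf (random_subset E (?a V)) G / pmf (random_subset E (\<lambda>_. q)) G) =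
      (\<Sum>G\<in>Pow E. \<Prod>e\<in>E. if e \<in> G then ?a U e * ?a V e / q
         else (1 - ?a U e) * (1 - ?a V e) / (1 - q))"
    using assms by (intro sum.cong refl)
      (auto simp: pmf_random_subset prod.distrib[symmetric] prod_dividef[symmetric] intro!: prod.cong)
  also have "\<dots> = (\<Prod>e\<in>E. ?a U e * ?a V e / q + (1 - ?a U e) * (1 - ?a V e) / (1 - q))"
    by (rule sum_Pow_prod_if[OF assms(1)])
  also have "\<dots> = (\<Prod>e\<in>E. if e \<in> U \<inter> V then 1 + (p - q)\<^sup>2 / (q * (1 - q)) else 1)"
    using assms by (intro prod.cong refl) (auto simp: field_simps power2_eq_square)
  also have "\<dots> = (1 + (p - q)\<^sup>2 / (q * (1 - q))) ^ card (E \<inter> U \<inter> V)"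
    using assms(1) by (simp add: prod.If_cases Int_assoc Collect_conj_eq)
  finally show ?thesis .
qed

section \<open>Exponential moment of the overlap of two planted sets\<close>

text \<open>The first two factors give the expected number of \<open>h\<close>-sets contained in two
  independent planted sets. This is at most \<open>exp (h * (1 - ln y))\<close>, where
  \<open>y\<close> is the ratio of \<open>h\<close> to the mean overlap, and the exponent
  \<open>l * (h choose 2)\<close> recovers only a small fraction of \<open>h * ln y\<close>.\<close>

lemma overlap_term_le:
  fixes K l :: real and N h :: nat
  assumes K: "1 \<le> K" "K \<le> real N"
    and h: "exp 4 * (K\<^sup>2 / N) < h" "h \<le> 2 * K"
    and l: "l \<le> exp (- 8) * (1 / K * ln (exp 1 * N / K))"
  shows "(N choose h) * (K / N) ^ (2 * h) * exp (l * (h choose 2)) \<le> (1 / 2) ^ h"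
proof -
  define \<mu> y where "\<mu> = K\<^sup>2 / N" and "y = h / \<mu>"
  have pos: "0 < K" "0 < real N" "0 < \<mu>" using K by (auto simp: \<mu>_def)
  have h0: "0 < h" using h(1) pos(3) unfolding \<mu>_def[symmetric]
    by (metis exp_gt_zero gr0I less_asym mult_pos_pos of_nat_0)
  have y: "exp 4 < y" using h(1) pos(3) unfolding y_def \<mu>_def[symmetric] by (simp add: field_simps)
  then have y0: "0 < y" by (meson exp_gt_zero less_trans)
  have lny: "4 < ln y" using y y0 by (metis exp_gt_zero ln_exp ln_less_cancel_iff)
  have "real (N choose h) * fact h \<le> real N ^ h"
    using binomial_fact_pow[of N h] by (metis of_nat_fact of_nat_le_iff of_nat_mult of_nat_power)
  moreover have "real h ^ h \<le> fact h * exp (real h)" by (rule power_le_fact_mult_exp) simp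
  ultimately have "real (N choose h) * real h ^ h \<le> exp (real h) * real N ^ h"
    by (smt (verit) exp_gt_zero mult.assoc mult.commute mult_left_mono of_nat_0_le_iff)
  then have "real (N choose h) \<le> exp (real h) * (real N / h) ^ h"
    using h0 by (simp add: field_simps)
  then have "(N choose h) * (K / N) ^ (2 * h) \<le> exp (real h) * (real N / h) ^ h * (K / N) ^ (2 * h)"
    using pos by (intro mult_right_mono) auto
  also have "\<dots> = exp (real h) * (1 / y) ^ h"
    unfolding power_mult mult.assoc power_mult_distrib[symmetric] y_def \<mu>_def
    using pos h0 by (simp add: field_simps power2_eq_square)
  also have "\<dots> = exp (h * (1 - ln y))"
    using y0 by (simp add: right_diff_distrib exp_diff exp_of_nat_mult power_divide)
  finally have 1: "(N choose h) * (K / N) ^ (2 * h) \<le> exp (h * (1 - ln y))" .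
  have e8: "exp (- 8 :: real) \<le> 1 / 8"
    using exp_ge_add_one_self[of "8::real"] by (simp add: exp_minus field_simps)
  have L0: "0 \<le> ln (exp 1 * N / K)"
    using K pos by (intro ln_ge_zero) (smt (verit) exp_ge_add_one_self le_divide_eq_1_pos mult_le_cancel_right1)
  \<comment> \<open>Since \<open>N / K = y * (K / h)\<close>, the logarithm in the bound on
    \<open>l\<close> splits into \<open>ln y\<close>, to be compared with the decay rate, and a term
    in \<open>K / h\<close>.\<close>
  have L: "ln (exp 1 * N / K) = 1 + ln y + ln (K / h)"
  proof -
    have "exp 1 * N / K = exp 1 * (y * (K / h))"
      using pos h0 by (simp add: y_def \<mu>_def field_simps power2_eq_square)
    then have "ln (exp 1 * N / K) = ln (exp 1 * (y * (K / h)))" by (rule arg_cong)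
    also have "\<dots> = ln (exp 1) + (ln y + ln (K / h))"
      using y0 pos h0 by (subst ln_mult_pos, simp, simp, subst ln_mult_pos, auto)
    finally show ?thesis by simp
  qed
  have "h / K * ln (exp 1 * N / K) \<le> 2 * (1 + ln y) + 1"
  proof -
    \<comment> \<open>The inequality \<open>ln t \<le> t - 1\<close> at \<open>t = K / h\<close>
      keeps this term bounded for small \<open>h\<close>; the truncation
      \<open>h \<le> 2 * K\<close> controls the term with \<open>ln y\<close>.\<close>
    have "h / K * ln (K / h) \<le> h / K * (K / h - 1)"
      using pos h0 by (intro mult_left_mono ln_le_minus_one) auto
    also have "\<dots> \<le> 1" using pos h0 by (simp add: field_simps)
    finally have "h / K * ln (K / h) \<le> 1" .
    moreover have "h / K * (1 + ln y) \<le> 2 * (1 + ln y)"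
      using h(2) pos lny by (intro mult_right_mono) (auto simp: field_simps)
    ultimately show ?thesis unfolding L by (simp add: distrib_left)
  qed
  moreover have "0 \<le> h / K * ln (exp 1 * N / K)" using L0 pos by simp
  ultimately have M: "exp (- 8) * (h / K * ln (exp 1 * N / K)) \<le> 1 / 8 * (2 * (1 + ln y) + 1)"
    using e8 lny by (intro mult_mono) auto
  have "real (h choose 2) = h * (real h - 1) / 2"
    using h0 by (simp add: choose_two real_of_nat_div of_nat_diff)
  then have b: "real (h choose 2) \<le> h * (h / 2)" by (simp add: field_simps)
  have "l * (h choose 2) \<le> exp (- 8) * (1 / K * ln (exp 1 * N / K)) * (h * (h / 2))"
    using l b L0 pos by (intro mult_mono) auto
  also have "\<dots> = h * (exp (- 8) * (h / K * ln (exp 1 * N / K)) / 2)" by simp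
  also have "\<dots> \<le> h * (1 / 8 * (2 * (1 + ln y) + 1) / 2)"
    using M by (intro mult_left_mono divide_right_mono) simp_all
  finally have 2: "l * (h choose 2) \<le> h * (1 / 8 * (2 * (1 + ln y) + 1) / 2)" .
  have "(N choose h) * (K / N) ^ (2 * h) * exp (l * (h choose 2)) \<le>
      exp (h * (1 - ln y)) * exp (h * (1 / 8 * (2 * (1 + ln y) + 1) / 2))"
    using 1 2 by (intro mult_mono) auto
  also have "\<dots> = exp (h * (1 - ln y + 1 / 8 * (2 * (1 + ln y) + 1) / 2))"
    by (simp add: exp_add[symmetric] distrib_left)
  also have "\<dots> \<le> exp (real h * (- 1))"
  proof -
    \<comment> \<open>The left side equals \<open>19 / 16 - 7 / 8 * ln y\<close>, which is below
      \<open>- 37 / 16\<close> because \<open>4 < ln y\<close>.\<close>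
    have "1 - ln y + 1 / 8 * (2 * (1 + ln y) + 1) / 2 \<le> - 1"
      using lny by (simp add: field_simps)
    then show ?thesis by (simp only: exp_le_cancel_iff mult_left_mono of_nat_0_le_iff)
  qed
  also have "\<dots> = exp (- 1) ^ h" by (simp only: exp_of_nat_mult)
  also have "\<dots> \<le> (1 / 2) ^ h"
    using exp_ge_add_one_self[of "1::real"] by (intro power_mono) (auto simp: exp_minus field_simps)
  finally show ?thesis .
qed

text \<open>Each half of the minimum in \<open>l\<close> serves one range of overlaps. Up to
  \<open>exp 4 * \<mu>\<close> the bound with \<open>N ^ 2 / K ^ 4\<close> makes the exponential at
  most \<open>2\<close>; beyond it the logarithmic bound yields a geometric series with sum at most
  \<open>2\<close>.\<close>

lemma overlap_exp_moment_le:
  fixes K l :: real and V :: "'a set" and N :: nat and w :: "'a set \<Rightarrow> real"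
  assumes "finite V" and K: "1 \<le> K" "K \<le> card V"
  defines "N \<equiv> card V"
  defines "w \<equiv> pmf (random_subset V (\<lambda>_. K / N))"
  defines "l \<equiv> exp (- 8) * min (1 / K * ln (exp 1 * N / K)) (real N ^ 2 / K ^ 4)"
  shows "(\<Sum>S | S \<subseteq> V \<and> card S \<le> 2 * K. \<Sum>T | T \<subseteq> V \<and> card T \<le> 2 * K.
    w S * w T * exp (l * (card (S \<inter> T) choose 2))) \<le> 4"
proof -
  define J where "J = {S. S \<subseteq> V \<and> card S \<le> 2 * K}"
  define \<mu> where "\<mu> = K\<^sup>2 / N"
  define \<phi> where "\<phi> h = exp (l * (h choose 2))" for h :: nat
  define A where "A = {h. exp 4 * \<mu> < real h \<and> h \<le> 2 * K \<and> h \<le> N}"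
  define \<T> where "\<T> = {X. X \<subseteq> V \<and> card X \<in> A}"
  have pos: "0 < K" "0 < real N" "0 < \<mu>" using K by (auto simp: \<mu>_def N_def)
  have r: "K / N \<in> {0..1}" using K pos by (simp add: N_def)
  have fin: "finite \<T>" "finite J" "finite A" "finite (Pow V)"
    using assms(1) by (auto simp: \<T>_def J_def A_def)
  have w0: "0 \<le> w S" for S by (simp add: w_def)
  have w1: "sum w (Pow V) = 1"
    using random_subset_superset_prob[OF assms(1) _ r, of "{}"] by (simp add: w_def)
  \<comment> \<open>For large overlaps the term \<open>X = S \<inter> T\<close> alone suffices; the sum over all \<open>X\<close> is a union
    bound, whose summands factor over the independent sets \<open>S\<close> and \<open>T\<close>.\<close>
  have pt: "\<phi> (card (S \<inter> T)) \<le> 2 + (\<Sum>X\<in>\<T>. if X \<subseteq> S \<and> X \<subseteq> T then \<phi> (card X) else 0)"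
    if "S \<in> J" "T \<in> J" for S T
  proof -
    let ?X = "S \<inter> T"
    have nn: "0 \<le> (if X \<subseteq> S \<and> X \<subseteq> T then \<phi> (card X) else 0)" for X by (simp add: \<phi>_def)
    have X: "?X \<subseteq> V" "card ?X \<le> 2 * K" "card ?X \<le> N"
    proof -
      show "?X \<subseteq> V" using that by (auto simp: J_def)
      then show "card ?X \<le> N" unfolding N_def using assms(1) by (rule card_mono[rotated])
      have "finite S" using that assms(1) finite_subset by (auto simp: J_def)
      then have "card ?X \<le> card S" by (intro card_mono) auto
      then show "card ?X \<le> 2 * K" using that by (simp add: J_def)
    qed
    show ?thesis
    proof (cases "card ?X \<in> A")
      case True
      then have "?X \<in> \<T>" using X by (simp add: \<T>_def)
      then have "(if ?X \<subseteq> S \<and> ?X \<subseteq> T then \<phi> (card ?X) else 0) \<le>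
          (\<Sum>X\<in>\<T>. if X \<subseteq> S \<and> X \<subseteq> T then \<phi> (card X) else 0)"
        using nn fin by (intro member_le_sum) auto
      then show ?thesis by simp
    next
      case False
      let ?h = "card ?X"
      have h: "?h \<le> exp 4 * \<mu>" using False X by (auto simp: A_def)
      have "real (?h choose 2) \<le> real ?h * real ?h / 2"
        by (cases "?h") (auto simp: choose_two real_of_nat_div of_nat_diff field_simps)
      also have "\<dots> \<le> (exp 4 * \<mu>) * (exp 4 * \<mu>) / 2"
        using h pos by (intro divide_right_mono mult_mono) auto
      also have "\<dots> = exp 8 * \<mu>\<^sup>2 / 2" by (simp add: power2_eq_square exp_add[symmetric] field_simps)
      finally have b: "real (?h choose 2) \<le> exp 8 * \<mu>\<^sup>2 / 2" .
      have "l \<le> exp (- 8) * (real N ^ 2 / K ^ 4)"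
        unfolding l_def by (intro mult_left_mono) auto
      also have "real N ^ 2 / K ^ 4 = 1 / \<mu>\<^sup>2"
        using pos by (simp add: \<mu>_def power_divide)
      \<comment> \<open>The scale \<open>exp (- 8)\<close> in \<open>l\<close> is chosen to cancel
        the square of the threshold factor \<open>exp 4\<close>.\<close>
      finally have "l * (?h choose 2) \<le> exp (- 8) * (1 / \<mu>\<^sup>2) * (exp 8 * \<mu>\<^sup>2 / 2)"
        using b pos by (intro mult_mono) auto
      also have "\<dots> = 1 / 2" using pos by (simp add: exp_minus field_simps)
      finally have "\<phi> ?h \<le> exp (1 / 2)" by (simp add: \<phi>_def)
      also have "\<dots> \<le> 1 + 1 / 2 + (1 / 2)\<^sup>2" by (rule exp_bound) auto
      also have "\<dots> \<le> 2" by (simp add: power2_eq_square)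
      finally show ?thesis using sum_nonneg[of \<T>, OF nn] by (simp add: add_increasing2)
    qed
  qed
  have "(\<Sum>S\<in>J. \<Sum>T\<in>J. w S * w T * \<phi> (card (S \<inter> T))) \<le>
      (\<Sum>S\<in>J. \<Sum>T\<in>J. w S * w T * (2 + (\<Sum>X\<in>\<T>. if X \<subseteq> S \<and> X \<subseteq> T then \<phi> (card X) else 0)))"
    using pt w0 by (intro sum_mono mult_left_mono) auto
  \<comment> \<open>The truncation is now recorded in \<open>A\<close> through
    \<open>h \<le> 2 * K\<close>. All terms are nonnegative, so \<open>S\<close> and
    \<open>T\<close> may range over all of \<open>Pow V\<close>, where the containment probabilities
    are exact.\<close>
  also have "\<dots> \<le> (\<Sum>S\<in>Pow V. \<Sum>T\<in>Pow V. w S * w T *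
      (2 + (\<Sum>X\<in>\<T>. if X \<subseteq> S \<and> X \<subseteq> T then \<phi> (card X) else 0)))"
  proof -
    have nn: "0 \<le> w S * w T * (2 + (\<Sum>X\<in>\<T>. if X \<subseteq> S \<and> X \<subseteq> T then \<phi> (card X) else 0))" for S T
      using w0 by (intro mult_nonneg_nonneg add_nonneg_nonneg sum_nonneg) (auto simp: \<phi>_def)
    have "J \<subseteq> Pow V" by (auto simp: J_def)
    then have "(\<Sum>S\<in>J. \<Sum>T\<in>J. w S * w T * (2 + (\<Sum>X\<in>\<T>. if X \<subseteq> S \<and> X \<subseteq> T then \<phi> (card X) else 0)))
      \<le> (\<Sum>S\<in>J. \<Sum>T\<in>Pow V. w S * w T * (2 + (\<Sum>X\<in>\<T>. if X \<subseteq> S \<and> X \<subseteq> T then \<phi> (card X) else 0)))"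
      using fin nn by (intro sum_mono sum_mono2) auto
    also have "\<dots> \<le> (\<Sum>S\<in>Pow V. \<Sum>T\<in>Pow V. w S * w T * (2 + (\<Sum>X\<in>\<T>. if X \<subseteq> S \<and> X \<subseteq> T then \<phi> (card X) else 0)))"
      using fin nn \<open>J \<subseteq> Pow V\<close> by (intro sum_mono2 sum_nonneg) auto
    finally show ?thesis .
  qed
  also have "\<dots> = 2 + (\<Sum>X\<in>\<T>. (K / N) ^ (2 * card X) * \<phi> (card X))"
  proof -
    have "(\<Sum>S\<in>Pow V. \<Sum>T\<in>Pow V. w S * w T *
          (2 + (\<Sum>X\<in>\<T>. if X \<subseteq> S \<and> X \<subseteq> T then \<phi> (card X) else 0))) =
        (\<Sum>S\<in>Pow V. \<Sum>T\<in>Pow V. w S * w T * 2) +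
        (\<Sum>S\<in>Pow V. \<Sum>T\<in>Pow V. \<Sum>X\<in>\<T>.
          (if X \<subseteq> S then w S else 0) * (if X \<subseteq> T then w T else 0) * \<phi> (card X))"
      unfolding distrib_left sum.distrib sum_distrib_left
      by (intro arg_cong2[where f = "(+)"] sum.cong refl) auto
    also have "(\<Sum>S\<in>Pow V. \<Sum>T\<in>Pow V. w S * w T * 2) = 2"
      by (simp add: w1 sum_distrib_left[symmetric] sum_distrib_right[symmetric])
    also have "(\<Sum>S\<in>Pow V. \<Sum>T\<in>Pow V. \<Sum>X\<in>\<T>.
          (if X \<subseteq> S then w S else 0) * (if X \<subseteq> T then w T else 0) * \<phi> (card X)) =
        (\<Sum>X\<in>\<T>. \<Sum>S\<in>Pow V. \<Sum>T\<in>Pow V.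
          (if X \<subseteq> S then w S else 0) * (if X \<subseteq> T then w T else 0) * \<phi> (card X))"
      by (subst sum.swap[of _ "Pow V" \<T>], rule sum.cong[OF refl], rule sum.swap)
    also have "\<dots> = (\<Sum>X\<in>\<T>. (\<Sum>S\<in>Pow V. if X \<subseteq> S then w S else 0) *
          (\<Sum>T\<in>Pow V. if X \<subseteq> T then w T else 0) * \<phi> (card X))"
      unfolding sum_product by (simp only: sum_distrib_right)
    also have "\<dots> = (\<Sum>X\<in>\<T>. (K / N) ^ (2 * card X) * \<phi> (card X))"
      unfolding w_def using random_subset_superset_prob[OF assms(1) _ r]
      by (intro sum.cong refl) (auto simp: \<T>_def mult_2 power_add)
    finally show ?thesis .
  qed
  also have "(\<Sum>X\<in>\<T>. (K / N) ^ (2 * card X) * \<phi> (card X)) =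
      (\<Sum>h\<in>A. (N choose h) * (K / N) ^ (2 * h) * \<phi> h)"
  proof -
    have "(\<Sum>X\<in>\<T>. (K / N) ^ (2 * card X) * \<phi> (card X)) =
        (\<Sum>h\<in>A. \<Sum>X | X \<in> \<T> \<and> card X = h. (K / N) ^ (2 * card X) * \<phi> (card X))"
      using fin by (intro sum.group[symmetric]) (auto simp: \<T>_def)
    also have "\<dots> = (\<Sum>h\<in>A. (N choose h) * (K / N) ^ (2 * h) * \<phi> h)"
    proof (intro sum.cong refl)
      fix h assume "h \<in> A"
      then have "{X \<in> \<T>. card X = h} = {X. X \<subseteq> V \<and> card X = h}" by (auto simp: \<T>_def)
      then show "(\<Sum>X | X \<in> \<T> \<and> card X = h. (K / N) ^ (2 * card X) * \<phi> (card X)) =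
          (N choose h) * (K / N) ^ (2 * h) * \<phi> h"
        using n_subsets[OF assms(1), of h] by (simp add: N_def)
    qed
    finally show ?thesis .
  qed
  also have "\<dots> \<le> (\<Sum>h\<in>A. (1 / 2) ^ h)"
  proof (unfold \<phi>_def, intro sum_mono overlap_term_le)
    show "l \<le> exp (- 8) * (1 / K * ln (exp 1 * N / K))"
      unfolding l_def by (intro mult_left_mono) auto
  qed (use K in \<open>auto simp: A_def \<mu>_def N_def\<close>)
  also have "\<dots> \<le> (\<Sum>h. (1 / 2) ^ h)"
    using fin by (intro sum_le_suminf) auto
  also have "\<dots> = (2::real)" by (subst suminf_geometric) auto
  finally show ?thesis by (simp add: J_def \<phi>_def)
qed

section \<open>Application to the planted dense subgraph model\<close>

lemma finite_vertex_pairs [simp]: "finite (vertex_pairs N)"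
  by (rule finite_subset[of _ "Pow {..<N}"]) (auto simp: vertex_pairs_def)

lemma card_vertex_pairs_within:
  assumes "U \<subseteq> {..<N}"
  shows "card {e \<in> vertex_pairs N. e \<subseteq> U} = card U choose 2"
proof -
  have "{e \<in> vertex_pairs N. e \<subseteq> U} = {e. e \<subseteq> U \<and> card e = 2}"
    using assms by (auto simp: vertex_pairs_def)
  then show ?thesis using n_subsets[of U 2] finite_subset[OF assms] by simp
qed

lemma pmf_random_subset_pos:
  assumes "finite A" "X \<subseteq> A" "\<And>x. x \<in> A \<Longrightarrow> r x \<in> {0<..<1}"
  shows "0 < pmf (random_subset A r) X"
proof -
  have "pmf (random_subset A r) X = (\<Prod>x\<in>A. if x \<in> X then r x else 1 - r x)"
    using assms by (subst pmf_random_subset) (auto intro: less_imp_le)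
  also have "0 < \<dots>" using assms by (intro prod_pos) auto
  finally show ?thesis .
qed

lemma set_random_subset: "finite A \<Longrightarrow> set_pmf (random_subset A r) \<subseteq> Pow A"
  by (auto simp: random_subset_def)

lemma pmf_planted_dense_subgraph:
  "pmf (planted_dense_subgraph N K p q) G =
    (\<Sum>S\<in>Pow {..<N}. pmf (random_subset {..<N} (\<lambda>_. K / N)) S *
      pmf (random_subset (vertex_pairs N) (\<lambda>e. if e \<subseteq> S then p else q)) G)"
  unfolding planted_dense_subgraph_def pmf_bind
  using set_random_subset[of "{..<N}"]
  by (subst integral_measure_pmf[of "Pow {..<N}"]) auto

lemma pmf_random_subset_outside: "finite A \<Longrightarrow> G \<notin> Pow A \<Longrightarrow> pmf (random_subset A r) G = 0"
  using set_random_subset[of A r] by (auto simp: set_pmf_iff)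

lemma tv_dist_erdos_renyi_planted:
  "tv_dist (erdos_renyi N q) (planted_dense_subgraph N K p q) =
    1 / 2 * (\<Sum>G\<in>Pow (vertex_pairs N).
      \<bar>pmf (random_subset (vertex_pairs N) (\<lambda>_. q)) G -
        (\<Sum>S\<in>Pow {..<N}. pmf (random_subset {..<N} (\<lambda>_. K / N)) S *
          pmf (random_subset (vertex_pairs N) (\<lambda>e. if e \<subseteq> S then p else q)) G)\<bar>)"
  by (subst tv_dist_finite_support[of "Pow (vertex_pairs N)"])
    (auto simp: pmf_planted_dense_subgraph erdos_renyi_def pmf_random_subset_outside)

lemma tv_dist_le_1: "tv_dist P Q \<le> 1"
proof -
  have *: "integrable (count_space UNIV) (pmf M)" "(LINT x|count_space UNIV. pmf M x) = 1" for M :: "'a pmf"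
    by (auto simp: integrable_pmf integral_pmf)
  have "(LINT x|count_space UNIV. \<bar>pmf P x - pmf Q x\<bar>) \<le>
      (LINT x|count_space UNIV. pmf P x + pmf Q x)"
  proof (intro integral_mono Bochner_Integration.integrable_add integrable_abs
      Bochner_Integration.integrable_diff *)
    show "\<bar>pmf P x - pmf Q x\<bar> \<le> pmf P x + pmf Q x" for x
      using pmf_nonneg[of P x] pmf_nonneg[of Q x] by linarith
  qed
  also have "\<dots> = 2" by (simp add: *)
  finally show ?thesis by (simp add: tv_dist_def)
qed

text \<open>The mixture bound with \<open>J\<close> the planted sets of size at most
  \<open>2 * K\<close>. The factor \<open>1 / 2\<close> of the distance cancels the factor
  \<open>2\<close> on the discarded weight, which leaves the Chernoff bound for a mean of
  \<open>K\<close>. The edges planted by both \<open>S\<close> and \<open>T\<close> are the pairs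
  inside \<open>S \<inter> T\<close>.\<close>

lemma tv_dist_planted_le_second_moment:
  fixes K p q :: real
  assumes K: "0 \<le> K" "K \<le> real N" and q: "0 < q" "q < 1" and p: "p \<in> {0..1}"
  defines "w \<equiv> pmf (random_subset {..<N} (\<lambda>_. K / N))"
  shows "tv_dist (erdos_renyi N q) (planted_dense_subgraph N K p q) \<le>
    exp (- K / 8) + 1 / 2 * sqrt (\<Sum>S | S \<subseteq> {..<N} \<and> card S \<le> 2 * K.
      \<Sum>T | T \<subseteq> {..<N} \<and> card T \<le> 2 * K.
      w S * w T * ((1 + (p - q)\<^sup>2 / (q * (1 - q))) ^ (card (S \<inter> T) choose 2) - 1))"
proof -
  let ?E = "vertex_pairs N" and ?V = "{..<N}"
  let ?P = "pmf (random_subset ?E (\<lambda>_. q))"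
  let ?R = "\<lambda>S. pmf (random_subset ?E (\<lambda>e. if e \<subseteq> S then p else q))"
  define J where "J = {S. S \<subseteq> ?V \<and> card S \<le> 2 * K}"
  have r: "K / N \<in> {0..1}" using K by (auto simp: divide_le_eq_1)
  have Nr: "K / N * N = K" using K by auto
  have fin: "finite (Pow ?V)" "finite (Pow ?E)" by auto
  have "(\<Sum>G\<in>Pow ?E. \<bar>?P G - (\<Sum>S\<in>Pow ?V. w S * ?R S G)\<bar>) \<le> 2 * sum w (Pow ?V - J) +
    sqrt (\<Sum>S\<in>J. \<Sum>T\<in>J. w S * w T * ((\<Sum>G\<in>Pow ?E. ?R S G * ?R T G / ?P G) - 1))"
    using q by (intro mixture_l1_dist_le_second_moment)
      (auto simp: J_def w_def intro!: pmf_random_subset_pos sum_pmf_eq_1 set_random_subset)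
  moreover have "sum w (Pow ?V - J) \<le> exp (- K / 8)"
  proof -
    have "Pow ?V - J = {S. S \<subseteq> ?V \<and> 2 * (K / N * card ?V) < card S}"
      using Nr by (auto simp: J_def)
    then show ?thesis using random_subset_Chernoff[of ?V "K / N"] r Nr by (simp add: w_def)
  qed
  moreover have "(\<Sum>G\<in>Pow ?E. ?R S G * ?R T G / ?P G) =
      (1 + (p - q)\<^sup>2 / (q * (1 - q))) ^ (card (S \<inter> T) choose 2)" if "S \<in> J" for S T
  proof -
    have "?E \<inter> {e. e \<subseteq> S} \<inter> {e. e \<subseteq> T} = {e \<in> ?E. e \<subseteq> S \<inter> T}" by auto
    moreover have "S \<inter> T \<subseteq> ?V" using that by (auto simp: J_def)
    ultimately have "card (?E \<inter> {e. e \<subseteq> S} \<inter> {e. e \<subseteq> T}) = card (S \<inter> T) choose 2"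
      by (simp only: card_vertex_pairs_within)
    then show ?thesis
      using random_subset_likelihood_overlap[of ?E q p "{e. e \<subseteq> S}" "{e. e \<subseteq> T}"] q p
      by (simp only: mem_Collect_eq finite_vertex_pairs simp_thms)
  qed
  ultimately show ?thesis
    unfolding tv_dist_erdos_renyi_planted w_def[symmetric] J_def[symmetric] by simp
qed

section \<open>Choice of scale and the final bound\<close>

text \<open>The left side is \<open>(c - 1)\<^sup>2 * q / (1 - q)\<close>. The condition
  \<open>c * q \<le> 1\<close> means \<open>c - 1 \<le> c * (1 - q)\<close>, so one factor
  \<open>c - 1\<close> absorbs the denominator.\<close>

lemma chi_square_le:
  fixes c q :: real
  assumes "1 < c" "0 < q" "c * q \<le> 1"
  shows "(c * q - q)\<^sup>2 / (q * (1 - q)) \<le> c\<^sup>2 * q"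
proof -
  have q1: "q < 1" using mult_strict_right_mono[OF assms(1,2)] assms(3) by simp
  have "c - 1 \<le> c * (1 - q)" using assms by (simp add: algebra_simps)
  then have "(c - 1) * (c - 1) * q \<le> (c - 1) * (c * (1 - q)) * q"
    using assms by (intro mult_right_mono mult_left_mono) auto
  also have "\<dots> \<le> c * (c * (1 - q)) * q"
    using assms q1 by (intro mult_right_mono) auto
  finally have "(c - 1) * (c - 1) * q / (1 - q) \<le> c\<^sup>2 * q"
    using q1 by (simp add: divide_le_eq power2_eq_square algebra_simps)
  moreover have "(c * q - q)\<^sup>2 / (q * (1 - q)) = (c - 1) * (c - 1) * q / (1 - q)"
    using assms q1 by (simp add: field_simps power2_eq_square)
  ultimately show ?thesis by simp
qed

lemma tv_dist_planted_le:
  fixes N :: nat and K C q c :: real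
  assumes c: "1 < c" and K: "1 \<le> K" "K \<le> real N" and C: "0 < C" and q: "0 \<le> q" "c * q \<le> 1"
    and qC: "q \<le> C * min (1 / K * ln (exp 1 * real N / K)) (real N ^ 2 / K ^ 4)"
  shows "tv_dist (erdos_renyi N q) (planted_dense_subgraph N K (c * q) q)
    \<le> exp 4 * sqrt (C * c\<^sup>2) + exp (- K / 8)"
proof -
  define m where "m = min (1 / K * ln (exp 1 * real N / K)) (real N ^ 2 / K ^ 4)"
  define x where "x = C * c\<^sup>2"
  have x0: "0 < x" using C c by (simp add: x_def)
  have e: "exp 4 * sqrt x = sqrt (exp 8 * x)"
  proof -
    have "exp 8 = (exp 4 :: real)\<^sup>2" by (simp add: power2_eq_square exp_add[symmetric])
    then show ?thesis by (simp add: real_sqrt_mult)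
  qed
  \<comment> \<open>For \<open>q = 0\<close> both laws are concentrated on the empty graph. If
    \<open>1 \<le> exp 8 * x\<close>, the bound exceeds \<open>1\<close> and is trivial. Otherwise
    the likelihood ratio is defined and \<open>exp 8 * x\<close> is admissible as a convexity
    coefficient.\<close>
  consider "q = 0" | "1 \<le> exp 8 * x" | "0 < q" "exp 8 * x \<le> 1" using q(1) by linarith
  then show ?thesis unfolding x_def[symmetric]
  proof cases
    case 1
    have "sum (pmf (random_subset {..<N} (\<lambda>_. K / N))) (Pow {..<N}) = 1"
      by (intro sum_pmf_eq_1 set_random_subset) auto
    then have "tv_dist (erdos_renyi N q) (planted_dense_subgraph N K (c * q) q) = 0"
      unfolding tv_dist_erdos_renyi_planted 1 mult_zero_right if_cancel
      by (simp add: sum_distrib_right[symmetric])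
    then show "tv_dist (erdos_renyi N q) (planted_dense_subgraph N K (c * q) q)
      \<le> exp 4 * sqrt x + exp (- K / 8)" using x0 by simp
  next
    case 2
    then have "1 \<le> exp 4 * sqrt x" unfolding e by simp
    then show "tv_dist (erdos_renyi N q) (planted_dense_subgraph N K (c * q) q)
      \<le> exp 4 * sqrt x + exp (- K / 8)"
      using exp_ge_zero[of "- K / 8"]
        tv_dist_le_1[of "erdos_renyi N q" "planted_dense_subgraph N K (c * q) q"] by linarith
  next
    case 3
    define \<theta> where "\<theta> = (c * q - q)\<^sup>2 / (q * (1 - q))"
    define w where "w = pmf (random_subset {..<N} (\<lambda>_. K / N))"
    define J where "J = {S. S \<subseteq> {..<N} \<and> card S \<le> 2 * K}"
    have q1: "q < 1" using mult_strict_right_mono[OF c 3(1)] q(2) by simp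
    have \<theta>0: "0 \<le> \<theta>" using 3 q1 by (simp add: \<theta>_def)
    have "\<theta> \<le> c\<^sup>2 * q" unfolding \<theta>_def using c 3(1) q(2) by (rule chi_square_le)
    also have "\<dots> \<le> c\<^sup>2 * (C * m)" using qC unfolding m_def by (intro mult_left_mono) auto
    finally have \<theta>: "\<theta> \<le> x * m" by (simp add: x_def mult_ac)
    \<comment> \<open>The exponent \<open>b * x * m\<close> is \<open>exp 8 * x\<close> times the
      exponent at the fixed scale \<open>exp (- 8)\<close>. Convexity pulls this coefficient out;
      the \<open>- 1\<close> must be kept until then.\<close>
    have b: "(1 + \<theta>) ^ b - 1 \<le> exp 8 * x * exp (exp (- 8) * m * b)" for b
    proof -
      have "(1 + \<theta>) ^ b \<le> exp \<theta> ^ b"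
        using \<theta>0 by (intro power_mono) auto
      also have "\<dots> = exp (b * \<theta>)" by (simp add: exp_of_nat_mult)
      also have "\<dots> \<le> exp (b * (x * m))" using \<theta> by (simp add: mult_left_mono)
      also have "b * (x * m) = exp 8 * x * (exp (- 8) * m * b)" by (simp add: exp_minus)
      finally have "(1 + \<theta>) ^ b - 1 \<le> exp (exp 8 * x * (exp (- 8) * m * b)) - 1" by simp
      also have "\<dots> \<le> exp 8 * x * (exp (exp (- 8) * m * b) - 1)"
        using x0 3 by (intro exp_mult_diff_le) auto
      also have "\<dots> \<le> exp 8 * x * exp (exp (- 8) * m * b)"
        using x0 by (intro mult_left_mono) auto
      finally show ?thesis .
    qed
    have "(\<Sum>S\<in>J. \<Sum>T\<in>J. w S * w T * ((1 + \<theta>) ^ (card (S \<inter> T) choose 2) - 1)) \<le>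
        (\<Sum>S\<in>J. \<Sum>T\<in>J. w S * w T *
          (exp 8 * x * exp (exp (- 8) * m * (card (S \<inter> T) choose 2))))"
      by (intro sum_mono mult_left_mono b) (auto simp: w_def)
    also have "\<dots> = exp 8 * x * (\<Sum>S\<in>J. \<Sum>T\<in>J. w S * w T *
          exp (exp (- 8) * m * (card (S \<inter> T) choose 2)))"
      unfolding sum_distrib_left by (intro sum.cong refl) (simp only: mult_ac)
    also have "\<dots> \<le> exp 8 * x * 4"
      using overlap_exp_moment_le[of "{..<N}" K] K x0
      unfolding J_def w_def m_def by (intro mult_left_mono) auto
    finally have "1 / 2 * sqrt (\<Sum>S\<in>J. \<Sum>T\<in>J. w S * w T * ((1 + \<theta>) ^ (card (S \<inter> T) choose 2) - 1))
        \<le> 1 / 2 * sqrt (exp 8 * x * 4)"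
      by (intro mult_left_mono real_sqrt_le_mono) auto
    \<comment> \<open>The root of the moment bound \<open>4\<close> cancels the prefactor
      \<open>1 / 2\<close>.\<close>
    also have "\<dots> = exp 4 * sqrt x" unfolding e by (simp add: real_sqrt_mult)
    finally have "1 / 2 * sqrt (\<Sum>S\<in>J. \<Sum>T\<in>J. w S * w T * ((1 + \<theta>) ^ (card (S \<inter> T) choose 2) - 1))
        \<le> exp 4 * sqrt x" .
    moreover have "tv_dist (erdos_renyi N q) (planted_dense_subgraph N K (c * q) q) \<le> exp (- K / 8) +
        1 / 2 * sqrt (\<Sum>S\<in>J. \<Sum>T\<in>J. w S * w T * ((1 + \<theta>) ^ (card (S \<inter> T) choose 2) - 1))"
      unfolding \<theta>_def J_def w_def
      using K 3 q1 q c by (intro tv_dist_planted_le_second_moment) auto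
    ultimately show "tv_dist (erdos_renyi N q) (planted_dense_subgraph N K (c * q) q)
        \<le> exp 4 * sqrt x + exp (- K / 8)" by linarith
  qed
qed

theorem proposition1:
  fixes c :: real
  assumes "c > 1"
  shows "\<exists>h :: real \<Rightarrow> real. (\<forall>x\<ge>0. 0 \<le> h x) \<and> (h \<longlongrightarrow> 0) (at_right 0) \<and>
    (\<forall>(N::nat) (K::real) (C::real) (q::real) (p::real).
       1 \<le> K \<longrightarrow> K \<le> real N \<longrightarrow> 0 < C \<longrightarrow> 0 \<le> q \<longrightarrow>
       q \<le> C * min (1 / K * ln (exp 1 * real N / K)) (real N ^ 2 / K ^ 4) \<longrightarrow>
       p = c * q \<longrightarrow> p \<le> 1 \<longrightarrow>
       tv_dist (erdos_renyi N q) (planted_dense_subgraph N K p q) \<le> h (C * c ^ 2) + exp (- K / 8))"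
\<comment> \<open>The square root comes from Cauchy--Schwarz, and the witness is the same for every
  \<open>c\<close>.\<close>
proof (intro exI[of _ "\<lambda>x. exp 4 * sqrt x"] conjI allI impI)
  have "((\<lambda>x. exp 4 * sqrt x) \<longlongrightarrow> exp 4 * sqrt 0) (at_right 0)"
    by (intro tendsto_intros)
  then show "((\<lambda>x. exp 4 * sqrt x) \<longlongrightarrow> 0) (at_right 0)" by simp
next
  fix N :: nat and K C q p :: real
  assume "1 \<le> K" "K \<le> real N" "0 < C" "0 \<le> q" "p = c * q" "p \<le> 1"
    "q \<le> C * min (1 / K * ln (exp 1 * real N / K)) (real N ^ 2 / K ^ 4)"
  then show "tv_dist (erdos_renyi N q) (planted_dense_subgraph N K p q)
      \<le> exp 4 * sqrt (C * c ^ 2) + exp (- K / 8)"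
    using tv_dist_planted_le[of c K N C q] assms by simp
qed auto

end
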